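(* Every regular $\mathscr{D}$-class of the endomorphism monoid of the countable universal graph $R$ contains $2^{\aleph_0}$ many $\mathscr{L}$-classes and $2^{\aleph_0}$ many $\mathscr{R}$-classes.
   Context: A graph is a pair $(V,E)$ with $E$ an irreflexive symmetric binary relation on $V$. The countable universal graph $R$ is the Fraïssé limit of the finite graphs. $\operatorname{End} R$ is its endomorphism monoid. Green's relations on a monoid $M$: $f\,\mathscr{L}\,g$ iff $Mf=Mg$; $f\,\mathscr{R}\,g$ iff $fM=gM$; $\mathscr{D}=\mathscr{L}\circ\mathscr{R}$. An element $f$ is regular if $fgf=f$ for some $g\in M$; a regular $\mathscr{D}$-class is one consisting of regular elements. *)

theory Defs
  imports "HOL-Algebra.Coset" "HOL-Library.Countable_Set" "HOL-Library.Equipollence"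
begin

type_synonym 'a graph = "'a set \<times> 'a rel"

abbreviation verts :: "'a graph \<Rightarrow> 'a set" where
  "verts G \<equiv> fst G"

abbreviation edges :: "'a graph \<Rightarrow> 'a rel" where
  "edges G \<equiv> snd G"

definition is_graph :: "'a graph \<Rightarrow> bool" where
  "is_graph G \<longleftrightarrow> edges G \<subseteq> verts G \<times> verts G \<and> irrefl (edges G) \<and> sym (edges G)"

definition induced_subgraph :: "'a graph \<Rightarrow> 'a set \<Rightarrow> 'a graph" where
  "induced_subgraph G A = (A, edges G \<inter> A \<times> A)"

definition graph_embedding :: "('a \<Rightarrow> 'b) \<Rightarrow> 'a graph \<Rightarrow> 'b graph \<Rightarrow> bool" where
  "graph_embedding f G H \<longleftrightarrow>
     f ` verts G \<subseteq> verts H \<and> inj_on f (verts G) \<and>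
     (\<forall>x\<in>verts G. \<forall>y\<in>verts G. (x, y) \<in> edges G \<longleftrightarrow> (f x, f y) \<in> edges H)"

definition graph_iso :: "('a \<Rightarrow> 'b) \<Rightarrow> 'a graph \<Rightarrow> 'b graph \<Rightarrow> bool" where
  "graph_iso f G H \<longleftrightarrow> graph_embedding f G H \<and> f ` verts G = verts H"

definition homogeneous :: "'a graph \<Rightarrow> bool" where
  "homogeneous G \<longleftrightarrow>
     (\<forall>A B f. finite A \<and> A \<subseteq> verts G \<and> B \<subseteq> verts G \<and>
        graph_iso f (induced_subgraph G A) (induced_subgraph G B) \<longrightarrow>
        (\<exists>h. graph_iso h G G \<and> (\<forall>x\<in>A. h x = f x)))"

text \<open>
  A Fraisse limit of a class is a countable homogeneous structure whose age is that class. For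
  the class of all finite graphs, only one inclusion between the ages needs to be required,
  since finite induced subgraphs of a graph are finite graphs; up to isomorphism every finite
  graph has its vertices in \<^typ>\<open>nat\<close>.
\<close>

definition universal_graph :: "'a graph \<Rightarrow> bool" where
  "universal_graph G \<longleftrightarrow>
     is_graph G \<and> countable (verts G) \<and> homogeneous G \<and>
     (\<forall>H :: nat graph. is_graph H \<and> finite (verts H) \<longrightarrow> (\<exists>f. graph_embedding f H G))"

text \<open>
  Endomorphisms are extensional functions, so that equality of monoid elements is equality on
  the vertex set.
\<close>

definition End_monoid :: "'a graph \<Rightarrow> ('a \<Rightarrow> 'a) monoid" where
  "End_monoid G =
     \<lparr>carrier = {f \<in> verts G \<rightarrow>\<^sub>E verts G. \<forall>(x, y)\<in>edges G. (f x, f y) \<in> edges G},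
      mult = compose (verts G),
      one = restrict id (verts G)\<rparr>"

lemma monoid_End_monoid:
  assumes "is_graph G"
  shows "monoid (End_monoid G)"
proof -
  have "edges G \<subseteq> verts G \<times> verts G"
    using assms by (simp add: is_graph_def)
  then show ?thesis
    by (intro monoidI)
       (auto simp: End_monoid_def compose_def PiE_iff extensional_def fun_eq_iff
          restrict_def split: prod.splits; blast?)+
qed

definition green_L :: "('a, 'b) monoid_scheme \<Rightarrow> 'a rel" where
  "green_L M = {(f, g). f \<in> carrier M \<and> g \<in> carrier M \<and>
     carrier M #>\<^bsub>M\<^esub> f = carrier M #>\<^bsub>M\<^esub> g}"

definition green_R :: "('a, 'b) monoid_scheme \<Rightarrow> 'a rel" where
  "green_R M = {(f, g). f \<in> carrier M \<and> g \<in> carrier M \<and>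
     f <#\<^bsub>M\<^esub> carrier M = g <#\<^bsub>M\<^esub> carrier M}"

text \<open>
  The two Green relations commute, so the order of the factors is immaterial.
\<close>

definition green_D :: "('a, 'b) monoid_scheme \<Rightarrow> 'a rel" where
  "green_D M = green_L M O green_R M"

definition regular_element :: "('a, 'b) monoid_scheme \<Rightarrow> 'a \<Rightarrow> bool" where
  "regular_element M f \<longleftrightarrow>
     f \<in> carrier M \<and> (\<exists>g\<in>carrier M. f \<otimes>\<^bsub>M\<^esub> g \<otimes>\<^bsub>M\<^esub> f = f)"

definition regular_D_class :: "('a, 'b) monoid_scheme \<Rightarrow> 'a set \<Rightarrow> bool" where
  "regular_D_class M D \<longleftrightarrow> D \<in> carrier M // green_D M \<and> (\<forall>f\<in>D. regular_element M f)"

end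

theory Submission imports Defs begin

text \<open>
  Let \<open>f\<close> be a regular element and \<open>H\<close> its image, which is a retract of \<open>R\<close>. Every finite subset
  of \<open>H\<close> has a common neighbour in \<open>H\<close>. Consequently, if \<open>w\<close> embeds a countable graph \<open>K\<close> in \<open>R\<close>
  such that every vertex outside the image of \<open>w\<close> has only finitely many neighbours in that
  image, then every homomorphism from \<open>K\<close> to \<open>H\<close> extends along \<open>w\<close> to a homomorphism from \<open>R\<close>
  to \<open>H\<close>; such a \<open>w\<close> exists for every \<open>K\<close> by a greedy construction. Take for \<open>K\<close> the graph
  consisting of \<open>H\<close> with every vertex doubled, together with infinitely many isolated vertices.
  Choosing one of the two copies of each vertex of \<open>H\<close> gives continuum many sections \<open>u\<close>, and
  choosing images of the isolated vertices gives continuum many retractions \<open>v\<close>, all with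
  \<open>v u = id\<close>. The products \<open>u v\<close> lie in the \<open>\<D>\<close>-class of \<open>f\<close>; their images determine \<open>u\<close> and
  their kernels determine \<open>v\<close>.
\<close>

section \<open>Green's relations\<close>

text \<open>Since \<open>M\<close> has a unit, \<open>f\<close> lies in the left ideal that it
  generates; equality of two such ideals therefore yields mutual left divisibility, and
  associativity gives the converse.\<close>

lemma green_L_iff:
  assumes "monoid M"
  shows "(f, g) \<in> green_L M \<longleftrightarrow> f \<in> carrier M \<and> g \<in> carrier M \<and>
    (\<exists>p\<in>carrier M. g = p \<otimes>\<^bsub>M\<^esub> f) \<and> (\<exists>q\<in>carrier M. f = q \<otimes>\<^bsub>M\<^esub> g)" (is "?l \<longleftrightarrow> ?r")
proof -
  interpret monoid M by fact
  show ?thesis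
  proof
    assume ?l
    then have *: "f \<in> carrier M" "g \<in> carrier M"
      and eq: "carrier M #>\<^bsub>M\<^esub> f = carrier M #>\<^bsub>M\<^esub> g"
      by (auto simp: green_L_def)
    have "f \<in> carrier M #>\<^bsub>M\<^esub> f" "g \<in> carrier M #>\<^bsub>M\<^esub> g"
      using * by (auto simp: r_coset_def intro!: bexI[of _ "\<one>\<^bsub>M\<^esub>"])
    then show ?r
      using * eq by (auto simp: r_coset_def)
  next
    assume ?r
    then obtain p q where *: "f \<in> carrier M" "g \<in> carrier M" "p \<in> carrier M" "q \<in> carrier M"
      and p: "g = p \<otimes>\<^bsub>M\<^esub> f" and q: "f = q \<otimes>\<^bsub>M\<^esub> g"
      by blast
    have "carrier M #>\<^bsub>M\<^esub> f \<subseteq> carrier M #>\<^bsub>M\<^esub> g"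
    proof
      fix x assume "x \<in> carrier M #>\<^bsub>M\<^esub> f"
      then obtain h where h: "h \<in> carrier M" "x = h \<otimes>\<^bsub>M\<^esub> f" by (auto simp: r_coset_def)
      then have "x = (h \<otimes>\<^bsub>M\<^esub> q) \<otimes>\<^bsub>M\<^esub> g" using * q by (metis m_assoc)
      then show "x \<in> carrier M #>\<^bsub>M\<^esub> g" using h * by (auto simp: r_coset_def)
    qed
    moreover have "carrier M #>\<^bsub>M\<^esub> g \<subseteq> carrier M #>\<^bsub>M\<^esub> f"
    proof
      fix x assume "x \<in> carrier M #>\<^bsub>M\<^esub> g"
      then obtain h where h: "h \<in> carrier M" "x = h \<otimes>\<^bsub>M\<^esub> g" by (auto simp: r_coset_def)
      then have "x = (h \<otimes>\<^bsub>M\<^esub> p) \<otimes>\<^bsub>M\<^esub> f" using * p by (metis m_assoc)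
      then show "x \<in> carrier M #>\<^bsub>M\<^esub> f" using h * by (auto simp: r_coset_def)
    qed
    ultimately show ?l using * by (auto simp: green_L_def)
  qed
qed

lemma green_R_iff:
  assumes "monoid M"
  shows "(f, g) \<in> green_R M \<longleftrightarrow> f \<in> carrier M \<and> g \<in> carrier M \<and>
    (\<exists>p\<in>carrier M. g = f \<otimes>\<^bsub>M\<^esub> p) \<and> (\<exists>q\<in>carrier M. f = g \<otimes>\<^bsub>M\<^esub> q)" (is "?l \<longleftrightarrow> ?r")
proof -
  interpret monoid M by fact
  show ?thesis
  proof
    assume ?l
    then have *: "f \<in> carrier M" "g \<in> carrier M"
      and eq: "f <#\<^bsub>M\<^esub> carrier M = g <#\<^bsub>M\<^esub> carrier M"
      by (auto simp: green_R_def)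
    have "f \<in> f <#\<^bsub>M\<^esub> carrier M" "g \<in> g <#\<^bsub>M\<^esub> carrier M"
      using * by (auto simp: l_coset_def intro!: bexI[of _ "\<one>\<^bsub>M\<^esub>"])
    then show ?r
      using * eq by (auto simp: l_coset_def)
  next
    assume ?r
    then obtain p q where *: "f \<in> carrier M" "g \<in> carrier M" "p \<in> carrier M" "q \<in> carrier M"
      and p: "g = f \<otimes>\<^bsub>M\<^esub> p" and q: "f = g \<otimes>\<^bsub>M\<^esub> q"
      by blast
    have "f <#\<^bsub>M\<^esub> carrier M \<subseteq> g <#\<^bsub>M\<^esub> carrier M"
    proof
      fix x assume "x \<in> f <#\<^bsub>M\<^esub> carrier M"
      then obtain h where h: "h \<in> carrier M" "x = f \<otimes>\<^bsub>M\<^esub> h" by (auto simp: l_coset_def)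
      then have "x = g \<otimes>\<^bsub>M\<^esub> (q \<otimes>\<^bsub>M\<^esub> h)" using * q by (metis m_assoc)
      then show "x \<in> g <#\<^bsub>M\<^esub> carrier M" using h * by (auto simp: l_coset_def)
    qed
    moreover have "g <#\<^bsub>M\<^esub> carrier M \<subseteq> f <#\<^bsub>M\<^esub> carrier M"
    proof
      fix x assume "x \<in> g <#\<^bsub>M\<^esub> carrier M"
      then obtain h where h: "h \<in> carrier M" "x = g \<otimes>\<^bsub>M\<^esub> h" by (auto simp: l_coset_def)
      then have "x = f \<otimes>\<^bsub>M\<^esub> (p \<otimes>\<^bsub>M\<^esub> h)" using * p by (metis m_assoc)
      then show "x \<in> f <#\<^bsub>M\<^esub> carrier M" using h * by (auto simp: l_coset_def)
    qed
    ultimately show ?l using * by (auto simp: green_R_def)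
  qed
qed

section \<open>Composition of the two relations and the resulting classes\<close>

lemma equiv_green_L: "equiv (carrier M) (green_L M)"
  by (auto simp: green_L_def equiv_def refl_on_def sym_def trans_def)

lemma equiv_green_R: "equiv (carrier M) (green_R M)"
  by (auto simp: green_R_def equiv_def refl_on_def sym_def trans_def)

text \<open>The square is completed by multiplication: with \<open>c = p d\<close> and
  \<open>x = d s\<close>, the element \<open>y = p x = c s\<close> is \<L>-related to
  \<open>x\<close> and \<R>-related to \<open>c\<close>.\<close>

lemma green_R_comp_green_L:
  assumes "monoid M"
  shows "green_R M O green_L M \<subseteq> green_L M O green_R M"
proof clarify
  interpret monoid M by fact
  fix x d c
  assume "(x, d) \<in> green_R M" "(d, c) \<in> green_L M"
  then obtain s t p q
    where *: "x \<in> carrier M" "d \<in> carrier M" "c \<in> carrier M"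
      "s \<in> carrier M" "t \<in> carrier M" "p \<in> carrier M" "q \<in> carrier M"
    and d: "d = x \<otimes>\<^bsub>M\<^esub> t" and x: "x = d \<otimes>\<^bsub>M\<^esub> s"
    and c: "c = p \<otimes>\<^bsub>M\<^esub> d" and d': "d = q \<otimes>\<^bsub>M\<^esub> c"
    unfolding green_L_iff[OF assms] green_R_iff[OF assms] by blast
  define y where "y = p \<otimes>\<^bsub>M\<^esub> x"
  have y: "y \<in> carrier M" using * by (simp add: y_def)
  have ycs: "y = c \<otimes>\<^bsub>M\<^esub> s" unfolding y_def using x c * by (metis m_assoc)
  have "x = q \<otimes>\<^bsub>M\<^esub> y" unfolding ycs using x d' * by (metis m_assoc)
  then have "(x, y) \<in> green_L M"
    unfolding green_L_iff[OF assms] using * y y_def by blast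
  moreover have "c = y \<otimes>\<^bsub>M\<^esub> t" unfolding y_def using c d * by (metis m_assoc)
  then have "(y, c) \<in> green_R M"
    unfolding green_R_iff[OF assms] using * y ycs by blast
  ultimately show "(x, c) \<in> green_L M O green_R M" by blast
qed

text \<open>A further \<R>-step is absorbed by the last factor of the composition; a further
  \<L>-step must first be moved in front of that factor by
  \<open>green_R_comp_green_L\<close>.\<close>

lemma green_D_closed:
  assumes "monoid M" "(f, d) \<in> green_D M"
  shows "green_L M `` {d} \<subseteq> green_D M `` {f}" "green_R M `` {d} \<subseteq> green_D M `` {f}"
proof -
  have L: "green_L M O green_L M \<subseteq> green_L M"
    using equiv_green_L[of M] by (auto simp: equiv_def trans_def)
  have R: "green_R M O green_R M \<subseteq> green_R M"
    using equiv_green_R[of M] by (auto simp: equiv_def trans_def)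
  obtain x where x: "(f, x) \<in> green_L M" "(x, d) \<in> green_R M"
    using assms(2) by (auto simp: green_D_def)
  show "green_L M `` {d} \<subseteq> green_D M `` {f}"
  proof clarify
    fix c assume "(d, c) \<in> green_L M"
    then have "(x, c) \<in> green_L M O green_R M"
      using x green_R_comp_green_L[OF assms(1)] by blast
    then show "(f, c) \<in> green_D M"
      unfolding green_D_def using x L by blast
  qed
  show "green_R M `` {d} \<subseteq> green_D M `` {f}"
    unfolding green_D_def using x R by blast
qed

text \<open>The element \<open>u f\<close> links the two: it is \<L>-related to \<open>f\<close>
  because \<open>v u f = f g f = f\<close>, and \<R>-related to \<open>u v\<close> because
  \<open>u f g v = u v\<close> and \<open>u v u f = u f\<close>.\<close>

lemma green_D_of_section_retraction:
  assumes "monoid M"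
    and in_M: "f \<in> carrier M" "g \<in> carrier M" "u \<in> carrier M" "v \<in> carrier M"
    and fgf: "f \<otimes>\<^bsub>M\<^esub> g \<otimes>\<^bsub>M\<^esub> f = f"
    and vu: "v \<otimes>\<^bsub>M\<^esub> u = f \<otimes>\<^bsub>M\<^esub> g"
    and u: "u \<otimes>\<^bsub>M\<^esub> (f \<otimes>\<^bsub>M\<^esub> g) = u"
  shows "(f, u \<otimes>\<^bsub>M\<^esub> v) \<in> green_D M"
proof -
  interpret monoid M by fact
  have "f = v \<otimes>\<^bsub>M\<^esub> (u \<otimes>\<^bsub>M\<^esub> f)"
    using in_M fgf vu by (metis m_assoc)
  then have "(f, u \<otimes>\<^bsub>M\<^esub> f) \<in> green_L M"
    unfolding green_L_iff[OF assms(1)] using in_M by blast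
  moreover have "(u \<otimes>\<^bsub>M\<^esub> f, u \<otimes>\<^bsub>M\<^esub> v) \<in> green_R M"
  proof -
    have "u \<otimes>\<^bsub>M\<^esub> v = (u \<otimes>\<^bsub>M\<^esub> f) \<otimes>\<^bsub>M\<^esub> (g \<otimes>\<^bsub>M\<^esub> v)"
      using in_M u by (metis m_assoc m_closed)
    moreover have "u \<otimes>\<^bsub>M\<^esub> f = (u \<otimes>\<^bsub>M\<^esub> v) \<otimes>\<^bsub>M\<^esub> (u \<otimes>\<^bsub>M\<^esub> f)"
      using in_M u vu by (metis m_assoc m_closed)
    ultimately show ?thesis
      unfolding green_R_iff[OF assms(1)] using in_M by (metis m_closed)
  qed
  ultimately show ?thesis by (auto simp: green_D_def)
qed

text \<open>The quotient is an image of \<open>A\<close>, which gives the upper bound; the pairwise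
  inequivalent elements \<open>d S\<close>, whose classes lie in \<open>D\<close>, give the lower
  bound.\<close>

lemma quotient_eqpoll_nat_set:
  fixes d :: "nat set \<Rightarrow> 'b"
  assumes "equiv A r" "A \<lesssim> (UNIV :: nat set set)"
    and "\<And>S. d S \<in> A" "\<And>S. r `` {d S} \<subseteq> D"
    and "\<And>S T. (d S, d T) \<in> r \<Longrightarrow> S = T"
  shows "{C \<in> A // r. C \<subseteq> D} \<approx> (UNIV :: nat set set)"
proof (rule lepoll_antisym)
  have "A // r = (\<lambda>x. r `` {x}) ` A" by (auto simp: quotient_def)
  then have "A // r \<lesssim> A" by (simp add: image_lepoll)
  then have "A // r \<lesssim> (UNIV :: nat set set)" using assms(2) by (rule lepoll_trans)
  then show "{C \<in> A // r. C \<subseteq> D} \<lesssim> (UNIV :: nat set set)"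
    by (rule lepoll_trans[OF subset_imp_lepoll, rotated]) blast
  have "inj (\<lambda>S. r `` {d S})"
  proof (rule injI)
    fix S T assume "r `` {d S} = r `` {d T}"
    then have "(d S, d T) \<in> r" using eq_equiv_class_iff[OF assms(1)] assms(3) by blast
    then show "S = T" by (rule assms(5))
  qed
  moreover have "range (\<lambda>S. r `` {d S}) \<subseteq> {C \<in> A // r. C \<subseteq> D}"
    using assms(3,4) by (auto intro!: quotientI)
  ultimately show "(UNIV :: nat set set) \<lesssim> {C \<in> A // r. C \<subseteq> D}"
    unfolding lepoll_def by blast
qed

section \<open>The universal graph\<close>

text \<open>This is the one-point extension property. A finite graph modelled on
  \<open>A \<union> B\<close> plus one vertex joined exactly to \<open>A\<close> embeds in
  \<open>R\<close> by universality; homogeneity then moves the copy of \<open>A \<union> B\<close>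
  back to its place.\<close>

lemma universal_graph_extension:
  assumes "universal_graph R" "finite A" "finite B" "A \<subseteq> verts R" "B \<subseteq> verts R" "A \<inter> B = {}"
  obtains z where "z \<in> verts R" "z \<notin> A \<union> B"
    "\<And>a. a \<in> A \<Longrightarrow> (z, a) \<in> edges R" "\<And>b. b \<in> B \<Longrightarrow> (z, b) \<notin> edges R"
proof -
  define F where "F = A \<union> B"
  define n where "n = card F"
  have F: "finite F" "F \<subseteq> verts R" using assms by (auto simp: F_def)
  have R: "irrefl (edges R)" "sym (edges R)" and hom: "homogeneous R"
    using assms(1) by (auto simp: universal_graph_def is_graph_def)
  obtain b where b: "bij_betw b {0..<n} F"
    using ex_bij_betw_nat_finite[OF F(1)] n_def by blast
  \<comment> \<open>Vertex \<open>i < n\<close> stands for \<open>b i\<close>, and \<open>n\<close>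
    is the new vertex, adjacent exactly to the copies of elements of \<open>A\<close>.\<close>
  define N :: "nat graph" where
    "N = ({0..n}, {(i, j). i < n \<and> j < n \<and> (b i, b j) \<in> edges R}
           \<union> {(i, j). i = n \<and> j < n \<and> b j \<in> A} \<union> {(i, j). j = n \<and> i < n \<and> b i \<in> A})"
  have "is_graph N"
    using R by (auto simp: is_graph_def N_def irrefl_def sym_def)
  moreover have "finite (verts N)" by (simp add: N_def)
  ultimately obtain f where f: "graph_embedding f N R"
    using assms(1) unfolding universal_graph_def by blast
  have fV: "f i \<in> verts R" if "i \<le> n" for i
    using f that by (auto simp: graph_embedding_def N_def)
  have finj: "inj_on f {0..n}"
    using f by (auto simp: graph_embedding_def N_def)
  have fE: "(f i, f j) \<in> edges R \<longleftrightarrow> (i, j) \<in> edges N" if "i \<le> n" "j \<le> n" for i j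
    using f that by (auto simp: graph_embedding_def N_def)
  have finj': "inj_on f {0..<n}" using finj by (rule inj_on_subset) auto
  define \<phi> where "\<phi> = b \<circ> inv_into {0..<n} f"
  have \<phi>: "\<phi> (f i) = b i" if "i < n" for i
    using that finj' by (simp add: \<phi>_def)
  have bij: "bij_betw \<phi> (f ` {0..<n}) F"
    unfolding \<phi>_def using b bij_betw_inv_into[OF inj_on_imp_bij_betw[OF finj']]
    by (rule bij_betw_trans[rotated])
  have "graph_iso \<phi> (induced_subgraph R (f ` {0..<n})) (induced_subgraph R F)"
    unfolding graph_iso_def graph_embedding_def
  proof (intro conjI ballI)
    fix x y
    assume "x \<in> verts (induced_subgraph R (f ` {0..<n}))" "y \<in> verts (induced_subgraph R (f ` {0..<n}))"
    then obtain i j where ij: "i < n" "j < n" "x = f i" "y = f j"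
      by (auto simp: induced_subgraph_def)
    moreover have "b i \<in> F" "b j \<in> F" using b ij by (auto simp: bij_betw_def)
    ultimately show "(x, y) \<in> edges (induced_subgraph R (f ` {0..<n})) \<longleftrightarrow>
        (\<phi> x, \<phi> y) \<in> edges (induced_subgraph R F)"
      using fE[of i j] by (auto simp: induced_subgraph_def \<phi> N_def)
  qed (use bij in \<open>auto simp: induced_subgraph_def bij_betw_def\<close>)
  moreover have "f ` {0..<n} \<subseteq> verts R" using fV by auto
  \<comment> \<open>The automorphism \<open>h\<close> extends \<open>\<phi>\<close>, so it takes
    each \<open>f i\<close> with \<open>i < n\<close> back to \<open>b i\<close>; the required
    vertex is \<open>h (f n)\<close>.\<close>
  ultimately obtain h where h: "graph_iso h R R" and h\<phi>: "\<And>x. x \<in> f ` {0..<n} \<Longrightarrow> h x = \<phi> x"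
    using hom F unfolding homogeneous_def by (metis finite_atLeastLessThan finite_imageI)
  have hb: "h (f i) = b i" if "i < n" for i using h\<phi> \<phi> that by auto
  have hE: "(h (f n), b i) \<in> edges R \<longleftrightarrow> b i \<in> A" and hne: "h (f n) \<noteq> b i" if "i < n" for i
  proof -
    have "(h (f n), h (f i)) \<in> edges R \<longleftrightarrow> (f n, f i) \<in> edges R"
      using h fV that by (simp add: graph_iso_def graph_embedding_def)
    then show "(h (f n), b i) \<in> edges R \<longleftrightarrow> b i \<in> A"
      using fE[of n i] that by (auto simp: hb N_def)
    have "f n \<noteq> f i" using inj_onD[OF finj, of n i] that by auto
    then have "h (f n) \<noteq> h (f i)"
      using h fV that by (auto simp: graph_iso_def graph_embedding_def inj_on_def)
    then show "h (f n) \<noteq> b i" using hb that by simp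
  qed
  have ex: "\<exists>i<n. x = b i" if "x \<in> F" for x
    using b that by (auto simp: bij_betw_def)
  show thesis
  proof
    show "h (f n) \<in> verts R" using h fV by (auto simp: graph_iso_def)
    show "h (f n) \<notin> A \<union> B" using ex hne by (auto simp: F_def)
    show "(h (f n), a) \<in> edges R" if "a \<in> A" for a
      using ex[of a] hE that by (auto simp: F_def)
    show "(h (f n), a) \<notin> edges R" if "a \<in> B" for a
      using ex[of a] hE that assms(6) by (auto simp: F_def)
  qed
qed

text \<open>Otherwise the extension property with \<open>A\<close> the whole vertex set would give a
  vertex outside it.\<close>

lemma universal_graph_infinite:
  assumes "universal_graph R"
  shows "infinite (verts R)"
proof
  assume "finite (verts R)"
  then show False
    using universal_graph_extension[OF assms, of "verts R" "{}"] by auto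
qed

section \<open>Locally finite embeddings and extension of homomorphisms\<close>

text \<open>The vertices \<open>w n\<close> are chosen one by one: each has the prescribed
  adjacencies to its predecessors and is not adjacent to those among the first \<open>n\<close>
  vertices of the enumeration \<open>r\<close> that have not yet been used. So a vertex
  \<open>r k\<close> outside the image can have only \<open>w 0\<close>, ..., \<open>w k\<close> as
  neighbours there.\<close>

lemma locally_finite_embedding:
  fixes adj :: "nat \<Rightarrow> nat \<Rightarrow> bool"
  assumes "universal_graph R"
    and sym_adj: "\<And>i j. adj i j \<Longrightarrow> adj j i" and irrefl_adj: "\<And>i. \<not> adj i i"
  obtains w :: "nat \<Rightarrow> 'a" where "inj w" "range w \<subseteq> verts R"
    "\<And>i j. (w i, w j) \<in> edges R \<longleftrightarrow> adj i j"
    "\<And>x. x \<in> verts R - range w \<Longrightarrow> finite {i. (w i, x) \<in> edges R}"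
proof -
  have R: "irrefl (edges R)" "sym (edges R)" "countable (verts R)"
    using assms(1) by (auto simp: universal_graph_def is_graph_def)
  define r where "r = from_nat_into (verts R)"
  have r: "bij_betw r UNIV (verts R)"
    unfolding r_def using R(3) universal_graph_infinite[OF assms(1)] by (rule bij_betw_from_nat_into)
  define P where "P w n z \<longleftrightarrow> z \<in> verts R \<and> (\<forall>i<n. z \<noteq> w i \<and> ((z, w i) \<in> edges R \<longleftrightarrow> adj n i)) \<and>
      (\<forall>i<n. r i \<notin> w ` {..<n} \<longrightarrow> (z, r i) \<notin> edges R)" for w n z
  have "\<exists>w. \<forall>n. P w n (w n)"
  proof (rule dependent_wellorder_choice)
    fix z n and f g :: "nat \<Rightarrow> 'a"
    assume "\<And>i. i < n \<Longrightarrow> f i = g i"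
    then show "P f n z = P g n z" unfolding P_def by (auto simp: image_iff)
  next
    fix n and w :: "nat \<Rightarrow> 'a"
    assume P: "\<And>i. i < n \<Longrightarrow> P w i (w i)"
    define A where "A = w ` {i. i < n \<and> adj n i}"
    \<comment> \<open>Removing \<open>A\<close> makes the two sets disjoint; as \<open>A\<close>
      contains only earlier values of \<open>w\<close>, every \<open>r i\<close> not yet used stays
      in \<open>B\<close>.\<close>
    define B where "B = (w ` {..<n} \<union> r ` {..<n}) - A"
    have wV: "w i \<in> verts R" if "i < n" for i using P[OF that] by (simp add: P_def)
    have winj: "w i \<noteq> w j" if "i < n" "j < n" "i \<noteq> j" for i j
      using that P[of i] P[of j] unfolding P_def by (metis nat_neq_iff)
    obtain z where z: "z \<in> verts R" "z \<notin> A \<union> B"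
      "\<And>a. a \<in> A \<Longrightarrow> (z, a) \<in> edges R" "\<And>b. b \<in> B \<Longrightarrow> (z, b) \<notin> edges R"
    proof (rule universal_graph_extension[OF assms(1), of A B])
      show "A \<subseteq> verts R" "B \<subseteq> verts R"
        using wV r by (auto simp: A_def B_def bij_betw_def)
    qed (auto simp: A_def B_def)
    have "P w n z"
      unfolding P_def
    proof (intro conjI allI impI)
      fix i assume i: "i < n"
      show "z \<noteq> w i" using z(2) i by (auto simp: A_def B_def)
      show "(z, w i) \<in> edges R \<longleftrightarrow> adj n i"
      proof (cases "adj n i")
        case True
        then show ?thesis using z(3) i by (auto simp: A_def)
      next
        case False
        then have "w i \<notin> A" using winj i by (auto simp: A_def)
        then have "w i \<in> B" using i by (auto simp: B_def)
        then show ?thesis using z(4) False by auto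
      qed
      assume "r i \<notin> w ` {..<n}"
      then have "r i \<in> B" using i by (auto simp: A_def B_def)
      then show "(z, r i) \<notin> edges R" using z(4) by auto
    qed (rule z(1))
    then show "\<exists>z. P w n z" by blast
  qed
  then obtain w where w: "\<And>n. P w n (w n)" by blast
  have less: "w j \<noteq> w i \<and> ((w j, w i) \<in> edges R \<longleftrightarrow> adj j i)" if "i < j" for i j
    using w[of j] that unfolding P_def by blast
  show thesis
  proof
    show "inj w" using less by (metis injI nat_neq_iff)
    show "range w \<subseteq> verts R" using w by (auto simp: P_def)
    show "(w i, w j) \<in> edges R \<longleftrightarrow> adj i j" for i j
    proof (cases i j rule: linorder_cases)
      case less
      then show ?thesis using \<open>\<And>i j. i < j \<Longrightarrow> _\<close>[of i j] sym_adj R(2) by (meson symD)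
    next
      case equal
      then show ?thesis using irrefl_adj R(1) by (auto simp: irrefl_def)
    next
      case greater
      then show ?thesis using less[of j i] by blast
    qed
    show "finite {i. (w i, x) \<in> edges R}" if x: "x \<in> verts R - range w" for x
    proof -
      obtain k where k: "x = r k" using x r by (auto simp: bij_betw_def)
      have "i \<le> k" if "(w i, x) \<in> edges R" for i
      proof (rule ccontr)
        assume "\<not> i \<le> k"
        moreover have "r k \<notin> w ` {..<i}" using x k by auto
        ultimately have "(w i, r k) \<notin> edges R"
          using w[of i] unfolding P_def by (metis not_le)
        then show False using that k by simp
      qed
      then have "{i. (w i, x) \<in> edges R} \<subseteq> {..k}" by auto
      then show ?thesis by (rule finite_subset) simp
    qed
  qed
qed

text \<open>Values on the image of \<open>w\<close> are forced. Any other vertex has only finitely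
  many neighbours there, so its value can be a common neighbour in \<open>H\<close> of their values
  and of all values chosen before; extra adjacencies do no harm to a homomorphism.\<close>

lemma homomorphism_extension:
  fixes w :: "nat \<Rightarrow> 'a"
  assumes R: "is_graph R" "countable (verts R)" "infinite (verts R)"
    and w: "inj w" "range w \<subseteq> verts R" "\<And>x. x \<in> verts R - range w \<Longrightarrow> finite {i. (w i, x) \<in> edges R}"
    and H: "\<And>A. finite A \<Longrightarrow> A \<subseteq> H \<Longrightarrow> \<exists>z\<in>H. \<forall>a\<in>A. (z, a) \<in> edges R"
    and \<phi>: "range \<phi> \<subseteq> H" "\<And>i j. (w i, w j) \<in> edges R \<Longrightarrow> (\<phi> i, \<phi> j) \<in> edges R"
  obtains v where "v \<in> verts R \<rightarrow> H" "\<And>x y. (x, y) \<in> edges R \<Longrightarrow> (v x, v y) \<in> edges R"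
    "\<And>i. v (w i) = \<phi> i"
proof -
  have E: "edges R \<subseteq> verts R \<times> verts R" "irrefl (edges R)" "sym (edges R)"
    using R(1) by (auto simp: is_graph_def)
  obtain r where r: "bij_betw r (UNIV :: nat set) (verts R)"
    using bij_betw_from_nat_into[OF R(2,3)] by blast
  \<comment> \<open>The values \<open>\<phi> i\<close> are known in advance, so the condition at a
    vertex outside the image covers all its neighbours \<open>w i\<close>, including those
    enumerated later.\<close>
  define P where "P f n z \<longleftrightarrow> z \<in> H \<and> (\<forall>i. r n = w i \<longrightarrow> z = \<phi> i) \<and>
      (r n \<notin> range w \<longrightarrow> (\<forall>i. (w i, r n) \<in> edges R \<longrightarrow> (z, \<phi> i) \<in> edges R)
         \<and> (\<forall>j<n. (z, f j) \<in> edges R))" for f n z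
  have "\<exists>f. \<forall>n. P f n (f n)"
  proof (rule dependent_wellorder_choice)
    fix z n and f g :: "nat \<Rightarrow> 'a"
    assume "\<And>i. i < n \<Longrightarrow> f i = g i"
    then show "P f n z = P g n z" unfolding P_def by auto
  next
    fix n and f :: "nat \<Rightarrow> 'a"
    assume P: "\<And>i. i < n \<Longrightarrow> P f i (f i)"
    show "\<exists>z. P f n z"
    proof (cases "r n \<in> range w")
      case True
      then obtain i where "r n = w i" by blast
      then have "P f n (\<phi> i)" using w(1) \<phi>(1) by (auto simp: P_def inj_eq)
      then show ?thesis by blast
    next
      case False
      define A where "A = \<phi> ` {i. (w i, r n) \<in> edges R} \<union> f ` {..<n}"
      have "r n \<in> verts R - range w" using False r by (auto simp: bij_betw_def)
      then have "finite A" using w(3) by (auto simp: A_def)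
      moreover have "A \<subseteq> H" using \<phi>(1) P by (auto simp: A_def P_def)
      ultimately obtain z where "z \<in> H" "\<forall>a\<in>A. (z, a) \<in> edges R" using H by blast
      then have "P f n z" using False by (auto simp: P_def A_def)
      then show ?thesis by blast
    qed
  qed
  then obtain f where f: "\<And>n. P f n (f n)" by blast
  define v where "v = f \<circ> inv_into UNIV r"
  have vr: "v (r n) = f n" for n using r by (simp add: v_def bij_betw_def)
  have hom_less: "(f j, f i) \<in> edges R" if "i < j" "(r j, r i) \<in> edges R" for i j
  proof (cases "r j \<in> range w")
    case False
    then show ?thesis using f[of j] that by (auto simp: P_def)
  next
    case True
    then obtain k where k: "r j = w k" by blast
    then have fj: "f j = \<phi> k" using f[of j] by (auto simp: P_def)
    show ?thesis
    proof (cases "r i \<in> range w")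
      case True
      then obtain l where l: "r i = w l" by blast
      then have "f i = \<phi> l" using f[of i] by (auto simp: P_def)
      then show ?thesis using fj \<phi>(2) k l that by simp
    next
      case False
      then have "(f i, \<phi> k) \<in> edges R" using f[of i] that k by (auto simp: P_def)
      then show ?thesis using fj E(3) by (simp add: symD)
    qed
  qed
  show thesis
  proof
    show "v \<in> verts R \<rightarrow> H"
    proof
      fix x assume "x \<in> verts R"
      then obtain n where "x = r n" using r by (auto simp: bij_betw_def)
      then show "v x \<in> H" using f[of n] by (simp add: vr P_def)
    qed
    show "(v x, v y) \<in> edges R" if xy: "(x, y) \<in> edges R" for x y
    proof -
      have "x \<in> verts R" "y \<in> verts R" using xy E by auto
      then obtain i j where ij: "x = r i" "y = r j" using r by (metis bij_betw_imp_surj_on imageE)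
      have "i \<noteq> j" using E(2) xy ij by (auto simp: irrefl_def)
      then show ?thesis
        using hom_less[of i j] hom_less[of j i] xy ij E(3) by (metis vr nat_neq_iff symD)
    qed
    show "v (w i) = \<phi> i" for i
    proof -
      have "w i \<in> verts R" using w(2) by auto
      then obtain n where "w i = r n" using r by (auto simp: bij_betw_def)
      then show ?thesis using f[of n] by (auto simp: vr P_def)
    qed
  qed
qed

text \<open>Being extensional, an endomorphism is determined by its graph over
  \<open>verts R\<close>, a subset of a countable set; the injection \<open>c\<close> codes it as a
  set of natural numbers.\<close>

lemma carrier_End_monoid_lepoll:
  assumes "countable (verts R)"
  shows "carrier (End_monoid R) \<lesssim> (UNIV :: nat set set)"
proof -
  define c where "c = to_nat_on (verts R \<times> verts R)"
  have c: "inj_on c (verts R \<times> verts R)"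
    unfolding c_def using assms by (intro inj_on_to_nat_on countable_SIGMA)
  define F where "F f = c ` ((\<lambda>x. (x, f x)) ` verts R)" for f :: "'a \<Rightarrow> 'a"
  have "inj_on F (carrier (End_monoid R))"
  proof (rule inj_onI)
    fix f g assume fg: "f \<in> carrier (End_monoid R)" "g \<in> carrier (End_monoid R)" and "F f = F g"
    then have f: "f \<in> verts R \<rightarrow>\<^sub>E verts R" and g: "g \<in> verts R \<rightarrow>\<^sub>E verts R"
      by (auto simp: End_monoid_def)
    have "(\<lambda>x. (x, f x)) ` verts R = (\<lambda>x. (x, g x)) ` verts R"
    proof (rule inj_on_image_eq_iff[OF c, THEN iffD1])
      show "c ` (\<lambda>x. (x, f x)) ` verts R = c ` (\<lambda>x. (x, g x)) ` verts R"
        using \<open>F f = F g\<close> by (simp add: F_def)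
    qed (use f g in auto)
    then have "f x = g x" if "x \<in> verts R" for x using that by auto
    then show "f = g" using f g by (meson PiE_ext)
  qed
  then show ?thesis unfolding lepoll_def by blast
qed

section \<open>Regular \<open>\<D>\<close>-classes\<close>

lemma End_monoid_mult:
  "x \<in> verts R \<Longrightarrow> (f \<otimes>\<^bsub>End_monoid R\<^esub> g) x = f (g x)"
  by (simp add: End_monoid_def compose_def)

lemma End_monoid_carrier_iff:
  "f \<in> carrier (End_monoid R) \<longleftrightarrow>
    f \<in> verts R \<rightarrow>\<^sub>E verts R \<and> (\<forall>x y. (x, y) \<in> edges R \<longrightarrow> (f x, f y) \<in> edges R)"
  by (auto simp: End_monoid_def)

lemma End_monoid_eqI:
  assumes "f \<in> carrier (End_monoid R)" "g \<in> carrier (End_monoid R)" "\<And>x. x \<in> verts R \<Longrightarrow> f x = g x"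
  shows "f = g"
  using assms unfolding End_monoid_carrier_iff by (meson PiE_ext)

text \<open>A common neighbour \<open>z\<close> of \<open>A\<close> exists in \<open>R\<close> by
  the extension property; \<open>e\<close> fixes \<open>A\<close> pointwise, so \<open>e z\<close>
  is a common neighbour inside \<open>H\<close>.\<close>

lemma retract_common_neighbour:
  assumes "universal_graph R" "e \<in> carrier (End_monoid R)" "e ` verts R = H"
    and fix_H: "\<And>x. x \<in> H \<Longrightarrow> e x = x"
    and A: "finite A" "A \<subseteq> H"
  shows "\<exists>z\<in>H. \<forall>a\<in>A. (z, a) \<in> edges R"
proof -
  have "A \<subseteq> verts R"
    using A assms(2,3) by (auto simp: End_monoid_carrier_iff)
  then obtain z where z: "z \<in> verts R" "\<And>a. a \<in> A \<Longrightarrow> (z, a) \<in> edges R"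
    using universal_graph_extension[OF assms(1) A(1), of "{}"]
    by (metis empty_subsetI finite.emptyI inf_bot_right)
  have "(e z, a) \<in> edges R" if "a \<in> A" for a
    using assms(2) z(2)[OF that] fix_H[of a] A(2) that unfolding End_monoid_carrier_iff
    by (metis subsetD)
  then show ?thesis using z(1) assms(3) by blast
qed

text \<open>Each \<open>u S\<close> is \<open>e\<close> followed by a section that picks one copy of
  every vertex of \<open>H\<close>, and each \<open>v T\<close> folds the copies together, whichever
  were picked. The picked copies are visible in the image of \<open>u S\<close>, the values at
  isolated vertices in the kernel of \<open>v T\<close>.\<close>

lemma sections_and_retractions:
  assumes R: "universal_graph R" and e: "e \<in> carrier (End_monoid R)" "e ` verts R = H"
    and fix_H: "\<And>x. x \<in> H \<Longrightarrow> e x = x"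
  obtains u v :: "nat set \<Rightarrow> 'a \<Rightarrow> 'a"
  where "\<And>S. u S \<in> carrier (End_monoid R)" "\<And>T. v T \<in> carrier (End_monoid R)"
    "\<And>S x. x \<in> verts R \<Longrightarrow> u S (e x) = u S x"
    "\<And>S T x. x \<in> verts R \<Longrightarrow> v T (u S x) = e x"
    "\<And>T x. x \<in> verts R \<Longrightarrow> e (v T x) = v T x"
    "\<And>S S'. u S ` verts R = u S' ` verts R \<Longrightarrow> S = S'"
    "\<And>T T'. \<forall>x\<in>verts R. \<forall>y\<in>verts R. v T x = v T y \<longleftrightarrow> v T' x = v T' y \<Longrightarrow> T = T'"
proof -
  have graph: "is_graph R" and ctbl: "countable (verts R)"
    using R by (auto simp: universal_graph_def)
  have E: "edges R \<subseteq> verts R \<times> verts R" "irrefl (edges R)" "sym (edges R)"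
    using graph by (auto simp: is_graph_def)
  have H_sub: "H \<subseteq> verts R" using e by (auto simp: End_monoid_carrier_iff)
  have ac: "\<exists>z\<in>H. \<forall>a\<in>A. (z, a) \<in> edges R" if "finite A" "A \<subseteq> H" for A
    using retract_common_neighbour[OF R e fix_H that] .
  \<comment> \<open>If \<open>H\<close> were finite, a common neighbour of \<open>H\<close> in
    \<open>H\<close> would be adjacent to itself.\<close>
  have "infinite H"
    using ac[of H] E(2) by (auto simp: irrefl_def)
  moreover have "countable H" using H_sub ctbl by (rule countable_subset)
  ultimately obtain h where h: "bij_betw h (UNIV :: nat set) H"
    using bij_betw_from_nat_into by blast
  have h_inj: "h m = h n \<longleftrightarrow> m = n" for m n
    using h by (auto simp: bij_betw_def inj_eq)
  have h_in: "h n \<in> H" for n using h by (auto simp: bij_betw_def)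
  \<comment> \<open>The vertices \<open>3 n\<close> and \<open>3 n + 1\<close> are the two copies of \<open>h n\<close>, and \<open>3 n + 2\<close> is isolated.\<close>
  define adj where "adj i j \<longleftrightarrow> i mod 3 < 2 \<and> j mod 3 < 2 \<and> (h (i div 3), h (j div 3)) \<in> edges R"
    for i j :: nat
  have adj: "adj i j \<Longrightarrow> adj j i" "\<not> adj i i" for i j
    using E(2,3) by (auto simp: adj_def irrefl_def dest: symD)
  obtain w where w: "inj w" "range w \<subseteq> verts R"
    "\<And>i j. (w i, w j) \<in> edges R \<longleftrightarrow> adj i j"
    "\<And>x. x \<in> verts R - range w \<Longrightarrow> finite {i. (w i, x) \<in> edges R}"
  proof (rule locally_finite_embedding[OF R, of adj, OF adj], assumption, goal_cases)
    case (1 w)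
    show thesis by (rule 1(1)[of w]) (fact 1(2-))+
  qed
  have wV: "w i \<in> verts R" for i using w(2) by auto
  \<comment> \<open>Both copies fold onto the original vertex; the isolated vertices are
    unconstrained, so \<open>T\<close> can decide between the distinct values \<open>h 0\<close> and
    \<open>h 1\<close>.\<close>
  define \<phi> where "\<phi> T i = (if i mod 3 < 2 then h (i div 3) else if i div 3 \<in> T then h 0 else h 1)"
    for T and i :: nat
  have "\<exists>v. v \<in> verts R \<rightarrow> H \<and> (\<forall>x y. (x, y) \<in> edges R \<longrightarrow> (v x, v y) \<in> edges R) \<and>
      (\<forall>i. v (w i) = \<phi> T i)" for T
  proof -
    have range: "range (\<phi> T) \<subseteq> H" using h_in by (auto simp: \<phi>_def)
    have hom: "(\<phi> T i, \<phi> T j) \<in> edges R" if "(w i, w j) \<in> edges R" for i j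
      using that w(3) by (auto simp: \<phi>_def adj_def)
    show ?thesis
      by (rule homomorphism_extension[OF graph ctbl universal_graph_infinite[OF R] w(1,2,4) ac range hom])
         blast+
  qed
  then obtain v' where v': "\<And>T. v' T \<in> verts R \<rightarrow> H"
    "\<And>T x y. (x, y) \<in> edges R \<Longrightarrow> (v' T x, v' T y) \<in> edges R" "\<And>T i. v' T (w i) = \<phi> T i"
    by metis
  define v where "v T = restrict (v' T) (verts R)" for T
  \<comment> \<open>\<open>of_bool\<close> selects the copy with index \<open>3 * n + 1\<close> if
    \<open>n \<in> S\<close>, and the one with index \<open>3 * n\<close> otherwise.\<close>
  define s where "s S n = w (3 * n + of_bool (n \<in> S))" for S n
  define u where "u S = restrict (\<lambda>x. s S (inv_into UNIV h (e x))) (verts R)" for S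
  have eV: "e x \<in> H" if "x \<in> verts R" for x using e that by auto
  have u_eq: "u S x = s S n" if "x \<in> verts R" "e x = h n" for S x n
    using that h by (simp add: u_def bij_betw_def)
  have ex_n: "\<exists>n. e x = h n" if "x \<in> verts R" for x
    using eV[OF that] h by (auto simp: bij_betw_def)
  have range_u: "u S ` verts R = range (s S)" for S
  proof
    show "u S ` verts R \<subseteq> range (s S)"
    proof clarify
      fix x assume "x \<in> verts R"
      then obtain n where "u S x = s S n" using u_eq ex_n by blast
      then show "u S x \<in> range (s S)" by simp
    qed
    have "s S n = u S (h n)" for n
      using u_eq[of "h n" n S] h_in[of n] H_sub fix_H by auto
    then show "range (s S) \<subseteq> u S ` verts R" using h_in H_sub by blast
  qed
  have v_w: "v T (w i) = \<phi> T i" for T i using wV v'(3) by (simp add: v_def)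
  have code: "(3 * n + of_bool b) mod 3 = (of_bool b :: nat)" "(3 * n + of_bool b) div 3 = n"
    for n :: nat and b by (cases b; simp)+
  have edge_s: "(s S m, s S n) \<in> edges R \<longleftrightarrow> (h m, h n) \<in> edges R" for S m n
    unfolding s_def w(3) adj_def code by simp
  show thesis
  proof
    show "u S \<in> carrier (End_monoid R)" for S
      unfolding End_monoid_carrier_iff
    proof (intro conjI allI impI)
      show "u S \<in> verts R \<rightarrow>\<^sub>E verts R" using wV by (auto simp: u_def s_def)
      fix x y assume xy: "(x, y) \<in> edges R"
      then have "x \<in> verts R" "y \<in> verts R" "(e x, e y) \<in> edges R"
        using E e by (auto simp: End_monoid_carrier_iff)
      moreover obtain m n where "e x = h m" "e y = h n"
        using ex_n calculation(1,2) by blast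
      ultimately show "(u S x, u S y) \<in> edges R"
        using u_eq[of x m] u_eq[of y n] edge_s by simp
    qed
    show "v T \<in> carrier (End_monoid R)" for T
      unfolding End_monoid_carrier_iff
    proof (intro conjI allI impI)
      show "v T \<in> verts R \<rightarrow>\<^sub>E verts R" using v'(1)[of T] H_sub by (auto simp: v_def)
      fix x y assume xy: "(x, y) \<in> edges R"
      then have "x \<in> verts R" "y \<in> verts R" using E by auto
      then show "(v T x, v T y) \<in> edges R" using v'(2) xy by (simp add: v_def)
    qed
    show "u S (e x) = u S x" if "x \<in> verts R" for S x
      using that eV[OF that] H_sub fix_H by (auto simp: u_def)
    show "v T (u S x) = e x" if x: "x \<in> verts R" for S T x
    proof -
      obtain n where n: "e x = h n" using ex_n x by blast
      show ?thesis unfolding u_eq[OF x n] s_def v_w \<phi>_def code n by simp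
    qed
    show "e (v T x) = v T x" if "x \<in> verts R" for T x
      using that v'(1)[of T] fix_H by (auto simp: v_def)
    show "S = S'" if "u S ` verts R = u S' ` verts R" for S S'
    proof -
      \<comment> \<open>By injectivity of \<open>w\<close> and division by 3, the vertex with index
        \<open>3 * n + 1\<close> can only be \<open>s S n\<close>, and only when
        \<open>n \<in> S\<close>.\<close>
      have in_range: "n \<in> S \<longleftrightarrow> w (3 * n + 1) \<in> range (s S)" for n S
      proof
        assume "n \<in> S"
        then have "s S n = w (3 * n + 1)" by (simp add: s_def)
        then show "w (3 * n + 1) \<in> range (s S)" by (metis rangeI)
      next
        assume "w (3 * n + 1) \<in> range (s S)"
        then obtain m where "3 * n + 1 = 3 * m + of_bool (m \<in> S)"
          using w(1) by (auto simp: s_def inj_eq)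
        then show "n \<in> S" by (cases "m \<in> S"; simp; presburger)
      qed
      show ?thesis
      proof (rule Set.set_eqI)
        show "n \<in> S \<longleftrightarrow> n \<in> S'" for n
          using in_range[of n S] in_range[of n S'] that unfolding range_u by simp
      qed
    qed
    show "T = T'" if ker: "\<forall>x\<in>verts R. \<forall>y\<in>verts R. v T x = v T y \<longleftrightarrow> v T' x = v T' y"
      for T T'
    proof -
      \<comment> \<open>\<open>w 0\<close> is a copy of \<open>h 0\<close> and serves as reference
        point: the isolated vertex numbered \<open>n\<close> shares its value exactly when
        \<open>n \<in> T\<close>.\<close>
      have T_iff: "n \<in> T \<longleftrightarrow> v T (w (3 * n + 2)) = v T (w 0)" for n T
      proof -
        have "(3 * n + 2) mod 3 = 2" "(3 * n + 2) div 3 = n" by presburger+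
        then show ?thesis unfolding v_w \<phi>_def by (simp add: h_inj)
      qed
      show ?thesis
      proof (rule Set.set_eqI)
        show "n \<in> T \<longleftrightarrow> n \<in> T'" for n
          using T_iff[of n T] T_iff[of n T'] ker wV by simp
      qed
    qed
  qed
qed

section \<open>The \<L>-classes and \<R>-classes inside a regular \<D>-class\<close>

theorem theorem3p9:
  fixes R :: "'a graph" and D :: "('a \<Rightarrow> 'a) set"
  assumes "universal_graph R"
    and "regular_D_class (End_monoid R) D"
  shows "{C \<in> carrier (End_monoid R) // green_L (End_monoid R). C \<subseteq> D} \<approx> (UNIV :: nat set set)
       \<and> {C \<in> carrier (End_monoid R) // green_R (End_monoid R). C \<subseteq> D} \<approx> (UNIV :: nat set set)"
proof -
  let ?M = "End_monoid R"
  have mon: "monoid ?M" and ctbl: "countable (verts R)"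
    using assms(1) by (auto simp: universal_graph_def monoid_End_monoid)
  interpret monoid ?M by (rule mon)
  obtain f where f: "f \<in> carrier ?M" and D: "D = green_D ?M `` {f}"
    and reg: "\<And>x. x \<in> D \<Longrightarrow> regular_element ?M x"
    using assms(2) by (auto simp: regular_D_class_def quotient_def)
  have "(f, f) \<in> green_L ?M" "(f, f) \<in> green_R ?M"
    using f by (auto simp: green_L_def green_R_def)
  then have "f \<in> D" unfolding D green_D_def by blast
  then obtain g where g: "g \<in> carrier ?M" and fgf: "f \<otimes>\<^bsub>?M\<^esub> g \<otimes>\<^bsub>?M\<^esub> f = f"
    using reg unfolding regular_element_def by blast
  \<comment> \<open>Since \<open>f g f = f\<close>, this is an idempotent with the same image as
    \<open>f\<close>, hence a retraction onto that image.\<close>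
  define e where "e = f \<otimes>\<^bsub>?M\<^esub> g"
  have e: "e \<in> carrier ?M" using f g by (simp add: e_def)
  have "e \<otimes>\<^bsub>?M\<^esub> e = (f \<otimes>\<^bsub>?M\<^esub> g \<otimes>\<^bsub>?M\<^esub> f) \<otimes>\<^bsub>?M\<^esub> g"
    using f g by (simp add: e_def m_assoc)
  then have idem: "e \<otimes>\<^bsub>?M\<^esub> e = e" by (simp only: fgf e_def)
  have fix_e: "e x = x" if x: "x \<in> e ` verts R" for x
  proof -
    obtain y where "y \<in> verts R" "x = e y" using x by blast
    then show ?thesis
      using End_monoid_mult[of y R e e] idem by simp
  qed
  obtain u v :: "nat set \<Rightarrow> 'a \<Rightarrow> 'a"
    where u: "\<And>S. u S \<in> carrier ?M" and v: "\<And>T. v T \<in> carrier ?M"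
    and ue: "\<And>S x. x \<in> verts R \<Longrightarrow> u S (e x) = u S x"
    and vu: "\<And>S T x. x \<in> verts R \<Longrightarrow> v T (u S x) = e x"
    and ev: "\<And>T x. x \<in> verts R \<Longrightarrow> e (v T x) = v T x"
    and im: "\<And>S S'. u S ` verts R = u S' ` verts R \<Longrightarrow> S = S'"
    and ker: "\<And>T T'. \<forall>x\<in>verts R. \<forall>y\<in>verts R. v T x = v T y \<longleftrightarrow> v T' x = v T' y
      \<Longrightarrow> T = T'"
  proof (rule sections_and_retractions[OF assms(1) e refl fix_e], assumption, goal_cases)
    case (1 u v)
    show thesis by (rule 1(1)[of u v]) (fact 1(2-))+
  qed
  have maps: "p x \<in> verts R" if "p \<in> carrier ?M" "x \<in> verts R" for p x
    using that by (auto simp: End_monoid_carrier_iff)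
  have vu_e: "v T \<otimes>\<^bsub>?M\<^esub> u S = e" for S T
    using u v e vu by (intro End_monoid_eqI) (auto simp: End_monoid_mult)
  have ue_u: "u S \<otimes>\<^bsub>?M\<^esub> e = u S" for S
    using u e ue by (intro End_monoid_eqI[of _ R]) (auto simp: End_monoid_mult)
  \<comment> \<open>Fixing \<open>S\<close> and varying \<open>T\<close> will separate \<L>-classes;
    fixing \<open>T\<close> and varying \<open>S\<close> will separate \<R>-classes.\<close>
  define d where "d S T = u S \<otimes>\<^bsub>?M\<^esub> v T" for S T
  have d: "d S T \<in> carrier ?M" for S T using u v by (simp add: d_def)
  have fd: "(f, d S T) \<in> green_D ?M" for S T
    unfolding d_def using vu_e ue_u unfolding e_def
    by (intro green_D_of_section_retraction[OF mon f g u v fgf])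
  \<comment> \<open>\<L>-related maps have the same kernel, and the kernel of \<open>d {} T\<close>
    is that of \<open>v T\<close>.\<close>
  have L_dist: "T = T'" if TT': "(d {} T, d {} T') \<in> green_L ?M" for T T'
  proof (intro ker ballI)
    fix x y assume xy: "x \<in> verts R" "y \<in> verts R"
    obtain p q where "d {} T' = p \<otimes>\<^bsub>?M\<^esub> d {} T" "d {} T = q \<otimes>\<^bsub>?M\<^esub> d {} T'"
      using TT' unfolding green_L_iff[OF mon] by blast
    then have "d {} T x = d {} T y \<longleftrightarrow> d {} T' x = d {} T' y"
      using End_monoid_mult[OF xy(1)] End_monoid_mult[OF xy(2)] by metis
    moreover have "d {} T x = d {} T y \<longleftrightarrow> v T x = v T y" for T
    proof
      assume "d {} T x = d {} T y"
      \<comment> \<open>Applying \<open>v T\<close> once more cancels \<open>u {}\<close>, because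
        \<open>v T u {} v T = e v T = v T\<close>.\<close>
      then have "v T (u {} (v T x)) = v T (u {} (v T y))"
        using xy by (simp add: d_def End_monoid_mult)
      then show "v T x = v T y"
        using xy by (simp add: vu ev maps[OF v])
    qed (use xy in \<open>simp add: d_def End_monoid_mult\<close>)
    ultimately show "v T x = v T y \<longleftrightarrow> v T' x = v T' y" by simp
  qed
  \<comment> \<open>\<R>-related maps have the same image, and the image of \<open>d S {}\<close> is
    that of \<open>u S\<close>.\<close>
  have R_dist: "S = S'" if SS': "(d S {}, d S' {}) \<in> green_R ?M" for S S'
  proof (rule im)
    have im_d: "d S {} ` verts R = u S ` verts R" for S
    proof
      show "d S {} ` verts R \<subseteq> u S ` verts R"
        using maps[OF v] by (simp add: d_def End_monoid_mult image_subset_iff)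
      \<comment> \<open>\<open>d S {}\<close> fixes the image of \<open>u S\<close> pointwise,
        because \<open>u S v {} u S = u S e = u S\<close>.\<close>
      have "u S x = d S {} (u S x)" if "x \<in> verts R" for x
        using that maps[OF u] by (simp add: d_def End_monoid_mult vu ue)
      then show "u S ` verts R \<subseteq> d S {} ` verts R"
        using maps[OF u] by blast
    qed
    obtain p q where pq: "p \<in> carrier ?M" "q \<in> carrier ?M"
      "d S' {} = d S {} \<otimes>\<^bsub>?M\<^esub> p" "d S {} = d S' {} \<otimes>\<^bsub>?M\<^esub> q"
      using SS' unfolding green_R_iff[OF mon] by blast
    have "d S' {} ` verts R \<subseteq> d S {} ` verts R"
      unfolding pq(3) using maps[OF pq(1)] by (simp add: End_monoid_mult image_subset_iff)
    moreover have "d S {} ` verts R \<subseteq> d S' {} ` verts R"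
      by (subst pq(4)) (use maps[OF pq(2)] in \<open>simp add: End_monoid_mult image_subset_iff\<close>)
    ultimately show "u S ` verts R = u S' ` verts R" unfolding im_d by (rule subset_antisym[rotated])
  qed
  have sub_D: "green_L ?M `` {d S T} \<subseteq> D" "green_R ?M `` {d S T} \<subseteq> D" for S T
    unfolding D by (rule green_D_closed[OF mon fd])+
  have "{C \<in> carrier ?M // green_L ?M. C \<subseteq> D} \<approx> (UNIV :: nat set set)"
    using equiv_green_L carrier_End_monoid_lepoll[OF ctbl] d sub_D(1) L_dist
    by (rule quotient_eqpoll_nat_set[where d = "d {}"])
  moreover have "{C \<in> carrier ?M // green_R ?M. C \<subseteq> D} \<approx> (UNIV :: nat set set)"
    using equiv_green_R carrier_End_monoid_lepoll[OF ctbl] d sub_D(2) R_dist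
    by (rule quotient_eqpoll_nat_set[where d = "\<lambda>S. d S {}"])
  ultimately show ?thesis by blast
qed

end
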